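(* Let $K$ be an algebraically closed field of characteristic different from $2$ and $3$. Let $B$ be the $5$-dimensional algebra over $K$ with basis $\{e_1,\ldots,e_5\}$ and products $$e_1\cdot e_1=e_2,\quad e_1\cdot e_4=e_4\cdot e_1=e_5,\quad e_1\cdot e_5=e_5\cdot e_1=-\tfrac12 e_3,\quad e_2\cdot e_4=e_4\cdot e_2=e_3,$$ all other products of basis vectors being zero. Then every Jacobi-Jordan algebra of dimension $5$ over $K$ is associative or isomorphic to $B$. The algebra $B$ is not associative. Moreover, $B$ is, up to isomorphism, the unique $5$-dimensional nilpotent Jordan algebra $A$ over $K$ of nilindex $3$ with $A^3\neq 0$.
   Context: An algebra over a field $K$ is a $K$-vector space with a bilinear product $x\cdot y$; neither associativity nor a unit is assumed. A Jacobi-Jordan algebra is an algebra $A$ over $K$ satisfying $x\cdot y=y\cdot x$ and $x\cdot(y\cdot z)+y\cdot(z\cdot x)+z\cdot(x\cdot y)=0$ for all $x,y,z\in A$. A Jordan algebra is a commutative algebra satisfying $x^2\cdot(y\cdot x)=(x^2\cdot y)\cdot x$ for all $x,y$. The principal powers of $x\in A$ are $x^1=x$, $x^{i+1}=x\cdot x^i$; $A$ is a nilalgebra of nilindex $n$ if $y^n=0$ for all $y\in A$ and there exists $x\in A$ with $x^{n-1}\ne0$. The powers of $A$ are $A^1=A$ and $A^k=\sum_{i+j=k}A^iA^j$ (sum over positive integers $i,j$) for $k\ge2$, where $A^iA^j$ is the linear span of all products $a\cdot b$ with $a\in A^i$, $b\in A^j$; $A$ is nilpotent if $A^k=(0)$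 for some $k$. *)

theory Defs
  imports "HOL-Analysis.Analysis" "HOL-Computational_Algebra.Polynomial"
begin

text \<open>An algebra occupies the whole type \<open>'a\<close>; it is given by its scalar multiplication
  and its product.\<close>

locale nonassoc_algebra = vector_space sc
  for sc :: "'k::field \<Rightarrow> 'a::ab_group_add \<Rightarrow> 'a" +
  fixes mul :: "'a \<Rightarrow> 'a \<Rightarrow> 'a"
  assumes linear_mul_right: "Vector_Spaces.linear sc sc (\<lambda>y. mul x y)"
    and linear_mul_left: "Vector_Spaces.linear sc sc (\<lambda>x. mul x y)"

locale commutative_algebra = nonassoc_algebra +
  assumes mul_commute: "mul x y = mul y x"

locale jacobi_jordan_algebra = commutative_algebra +
  assumes jacobi: "mul x (mul y z) + mul y (mul z x) + mul z (mul x y) = 0"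

locale jordan_algebra = commutative_algebra +
  assumes jordan: "mul (mul x x) (mul y x) = mul (mul (mul x x) y) x"

definition associative_mul :: "('a \<Rightarrow> 'a \<Rightarrow> 'a) \<Rightarrow> bool" where
  "associative_mul mul \<longleftrightarrow> (\<forall>x y z. mul (mul x y) z = mul x (mul y z))"

definition algebra_isomorphic ::
  "('k::field \<Rightarrow> 'a::ab_group_add \<Rightarrow> 'a) \<Rightarrow> ('a \<Rightarrow> 'a \<Rightarrow> 'a) \<Rightarrow>
   ('k \<Rightarrow> 'b::ab_group_add \<Rightarrow> 'b) \<Rightarrow> ('b \<Rightarrow> 'b \<Rightarrow> 'b) \<Rightarrow> bool" where
  "algebra_isomorphic sc mul sc' mul' \<longleftrightarrow>
     (\<exists>f. Vector_Spaces.linear sc sc' f \<and> bij f \<and> (\<forall>x y. f (mul x y) = mul' (f x) (f y)))"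

text \<open>Principal powers are indexed from \<open>1\<close>. The value at index \<open>0\<close> is a dummy, chosen so
  that the condition \<open>x\<^sup>n\<^sup>-\<^sup>1 \<noteq> 0\<close> below fails for \<open>n \<le> 1\<close>.\<close>

fun principal_power :: "('a::zero \<Rightarrow> 'a \<Rightarrow> 'a) \<Rightarrow> 'a \<Rightarrow> nat \<Rightarrow> 'a" where
  "principal_power mul x 0 = 0"
| "principal_power mul x (Suc 0) = x"
| "principal_power mul x (Suc (Suc i)) = mul x (principal_power mul x (Suc i))"

definition nilalgebra_of_nilindex :: "('a::zero \<Rightarrow> 'a \<Rightarrow> 'a) \<Rightarrow> nat \<Rightarrow> bool" where
  "nilalgebra_of_nilindex mul n \<longleftrightarrow>
     (\<forall>y. principal_power mul y n = 0) \<and> (\<exists>x. principal_power mul x (n - 1) \<noteq> 0)"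

definition product_span ::
  "('k::field \<Rightarrow> 'a::ab_group_add \<Rightarrow> 'a) \<Rightarrow> ('a \<Rightarrow> 'a \<Rightarrow> 'a) \<Rightarrow> 'a set \<Rightarrow> 'a set \<Rightarrow> 'a set" where
  "product_span sc mul S T = module.span sc {mul a b |a b. a \<in> S \<and> b \<in> T}"

text \<open>Powers are indexed from \<open>1\<close>; index \<open>0\<close> is a dummy. The outer sum is the pointwise sum of
  sets from \<^theory>\<open>HOL-Library.Set_Algebras\<close>, that is, the sum of subspaces.\<close>

fun algebra_power ::
  "('k::field \<Rightarrow> 'a::ab_group_add \<Rightarrow> 'a) \<Rightarrow> ('a \<Rightarrow> 'a \<Rightarrow> 'a) \<Rightarrow> nat \<Rightarrow> 'a set" where
  "algebra_power sc mul k =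
     (if k \<le> 1 then UNIV
      else \<Sum>i = 1..<k. product_span sc mul
             (algebra_power sc mul i) (algebra_power sc mul (k - i)))"

declare algebra_power.simps [simp del]

definition nilpotent_algebra ::
  "('k::field \<Rightarrow> 'a::ab_group_add \<Rightarrow> 'a) \<Rightarrow> ('a \<Rightarrow> 'a \<Rightarrow> 'a) \<Rightarrow> bool" where
  "nilpotent_algebra sc mul \<longleftrightarrow> (\<exists>k\<ge>1. algebra_power sc mul k = {0})"

text \<open>The algebra \<open>B\<close> lives on \<open>'k ^ 5\<close>. The five indices are the numerals \<open>1, \<dots>, 5\<close> of the
  index type \<open>5\<close>, in which \<open>5 = 0\<close>.\<close>

definition B_basis :: "5 \<Rightarrow> 'k::field ^ 5" where
  "B_basis i = axis i 1"

definition B_table :: "5 \<Rightarrow> 5 \<Rightarrow> 'k::field ^ 5" where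
  "B_table i j =
     (if (i, j) = (1, 1) then B_basis 2
      else if (i, j) \<in> {(1, 4), (4, 1)} then B_basis 5
      else if (i, j) \<in> {(1, 5), (5, 1)} then (- (1 / 2)) *s B_basis 3
      else if (i, j) \<in> {(2, 4), (4, 2)} then B_basis 3
      else 0)"

definition B_mul :: "'k::field ^ 5 \<Rightarrow> 'k ^ 5 \<Rightarrow> 'k ^ 5" where
  "B_mul x y = (\<Sum>i\<in>UNIV. \<Sum>j\<in>UNIV. (x $ i * y $ j) *s B_table i j)"

end

theory Submission
  imports Defs
begin

text \<open>
  Let \<open>2\<close> and \<open>3\<close> be invertible, and write \<open>L\<^sub>x\<close> for multiplication by \<open>x\<close>. The Jacobi identity says \<open>L\<^sub>x\<^sub>y = - (L\<^sub>x L\<^sub>y + L\<^sub>y L\<^sub>x)\<close>;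
  in particular \<open>L\<^sub>x\<^sub>x = - 2 L\<^sub>x\<^sup>2\<close>, and since \<open>x (x x) = 0\<close> this forces \<open>L\<^sub>x\<^sup>3 = 0\<close>. So every \<open>L\<^sub>x\<close> is
  nilpotent, which replaces any general nilpotency theorem below.

  If a Jacobi-Jordan algebra is not associative, then polarisation gives \<open>a\<close> and \<open>y\<close> with
  \<open>z = (a a) y \<noteq> 0\<close> (lemma \<open>nonassociative_obtains\<close>). Put \<open>b = a a\<close> and \<open>w = a y\<close>. The operator \<open>L\<^sub>a\<close>
  has the chains \<open>a \<mapsto> b \<mapsto> 0\<close> and \<open>y \<mapsto> w \<mapsto> - z / 2 \<mapsto> 0\<close>, and \<open>L\<^sub>y\<close> sends \<open>b\<close> to \<open>z\<close>; together
  with the nilpotency of \<open>L\<^sub>y\<close> this makes \<open>a, b, z, y, w\<close> linearly independent (lemma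
  \<open>lincomb5_eq_0D\<close>), so in dimension five they form a basis. All products with \<open>a\<close> and \<open>b\<close> are then
  known. The only unknown datum is \<open>y y\<close>: expanding it in the basis, nilpotency of \<open>L\<^sub>y\<close> and
  \<open>y (y y) = 0\<close> leave just two free coefficients, and adding suitable multiples of \<open>a\<close> and \<open>b\<close>
  to \<open>y\<close> makes the square vanish without changing \<open>z\<close> (lemma \<open>square_zero_replacement\<close>). Once
  \<open>y y = 0\<close>, the formula for \<open>L\<^sub>x\<^sub>y\<close> determines every remaining product, and the table is that of \<open>B\<close>
  with \<open>a, b, z, y, w\<close> in the places of the five basis vectors.

  A commutative nilalgebra of nilindex three is a Jacobi-Jordan algebra, because the Jacobi identity is
  the polarisation of \<open>x (x x) = 0\<close>. In an associative Jacobi-Jordan algebra the three terms of the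
  Jacobi identity coincide, so all triple products vanish and \<open>A\<^sup>3 = 0\<close>. Hence the last
  uniqueness claim follows from the classification.
\<close>

section \<open>Commutative algebras\<close>

context commutative_algebra
begin

lemma mul_add_right: "mul x (y + z) = mul x y + mul x z"
  and mul_sc_right: "mul x (sc c y) = sc c (mul x y)"
  and mul_zero_right [simp]: "mul x 0 = 0"
  and mul_minus_right [simp]: "mul x (- y) = - mul x y"
  using linear_mul_right[of x]
  by (simp_all add: linear_iff_module_hom module_hom.add module_hom.scale module_hom.zero
      module_hom.neg)

lemma mul_add_left: "mul (x + y) z = mul x z + mul y z"
  and mul_sc_left: "mul (sc c x) z = sc c (mul x z)"
  and mul_zero_left [simp]: "mul 0 z = 0"
  and mul_minus_left [simp]: "mul (- x) z = - mul x z"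
  by (simp_all add: mul_commute[of _ z] mul_add_right mul_sc_right)

lemma mul_diff_right: "mul x (y - z) = mul x y - mul x z"
  and mul_diff_left: "mul (x - y) z = mul x z - mul y z"
  using mul_add_right[of x y "- z"] mul_add_left[of x "- y" z] by simp_all

lemmas mul_expand = mul_add_right mul_add_left mul_diff_right mul_diff_left mul_sc_right mul_sc_left

lemma double_eq_0D:
  fixes v :: 'b
  assumes "(2::'a) \<noteq> 0" and "v + v = 0"
  shows "v = 0"
proof -
  have "sc 2 v = 0"
    using assms(2) scale_left_distrib[of 1 1 v] by simp
  then show ?thesis using assms(1) by simp
qed

lemma triple_eq_0D:
  fixes v :: 'b
  assumes "(3::'a) \<noteq> 0" and "v + v + v = 0"
  shows "v = 0"
proof -
  have "sc (1 + 1 + 1) v = 0"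
    unfolding scale_left_distrib using assms(2) by simp
  then show ?thesis using assms(1) by simp
qed

lemma jacobi_if_cubes_zero:
  assumes two: "(2::'a) \<noteq> 0" and cube: "\<And>x. mul x (mul x x) = 0"
  shows "mul x (mul y z) + mul y (mul z x) + mul z (mul x y) = 0" (is "?J = 0")
proof (rule double_eq_0D[OF two])
  \<comment> \<open>Inclusion-exclusion over the cubes of the partial sums isolates the terms that are linear
    in each of the three variables; by commutativity each of them occurs twice.\<close>
  define c where "c u = mul u (mul u u)" for u
  have "?J + ?J = c (x + y + z) - c (x + y) - c (y + z) - c (x + z) + c x + c y + c z"
    unfolding c_def
    by (simp add: mul_expand mul_commute[of y x] mul_commute[of z x] mul_commute[of z y] algebra_simps)
  also have "\<dots> = 0" by (simp add: c_def cube)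
  finally show "?J + ?J = 0" .
qed

lemma product_span_subset:
  assumes "module.subspace sc W" and "\<And>a b. a \<in> S \<Longrightarrow> b \<in> T \<Longrightarrow> mul a b \<in> W"
  shows "product_span sc mul S T \<subseteq> W"
  unfolding product_span_def using assms by (intro span_minimal) auto

lemma algebra_power_subset:
  assumes W: "module.subspace sc W" and "2 \<le> k"
    and "\<And>i. 1 \<le> i \<Longrightarrow> i < k \<Longrightarrow>
      product_span sc mul (algebra_power sc mul i) (algebra_power sc mul (k - i)) \<subseteq> W"
  shows "algebra_power sc mul k \<subseteq> W"
proof
  fix v assume "v \<in> algebra_power sc mul k"
  then have "v \<in> (\<Sum>i = 1..<k. product_span sc mul
      (algebra_power sc mul i) (algebra_power sc mul (k - i)))"
    using \<open>2 \<le> k\<close> by (subst (asm) algebra_power.simps) simp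
  then obtain f where v: "v = (\<Sum>i = 1..<k. f i)"
    and f: "\<And>i. i \<in> {1..<k} \<Longrightarrow>
      f i \<in> product_span sc mul (algebra_power sc mul i) (algebra_power sc mul (k - i))"
    by (subst (asm) set_sum_alt) auto
  show "v \<in> W"
    unfolding v using f assms(3) by (intro subspace_sum[OF W]) fastforce
qed

lemma zero_in_product_span: "0 \<in> product_span sc mul S T"
  by (simp add: product_span_def span_zero)

lemma zero_in_algebra_power: "0 \<in> algebra_power sc mul k"
proof (cases "k \<le> 1")
  case False
  have "0 \<in> (\<Sum>i\<in>I. product_span sc mul (S i) (T i))" for I and S T :: "nat \<Rightarrow> 'b set"
    using set_plus_intro[of "0::'b" _ 0, simplified] zero_in_product_span
    by (induction I rule: infinite_finite_induct) (auto intro: set_zero)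
  with False show ?thesis by (subst algebra_power.simps) simp
qed (subst algebra_power.simps, simp)

lemma algebra_power_1: "algebra_power sc mul 1 = UNIV"
  by (subst algebra_power.simps) simp

lemma mul_in_product_span: "a \<in> S \<Longrightarrow> b \<in> T \<Longrightarrow> mul a b \<in> product_span sc mul S T"
  unfolding product_span_def by (rule span_base) auto

lemma algebra_power_2: "algebra_power sc mul 2 = product_span sc mul UNIV UNIV"
proof -
  have "{1..<2::nat} = {1}" by auto
  then show ?thesis
    by (subst algebra_power.simps) (simp add: algebra_power_1[simplified])
qed

lemma algebra_power_3:
  "algebra_power sc mul 3 = product_span sc mul UNIV (algebra_power sc mul 2)
     + product_span sc mul (algebra_power sc mul 2) UNIV"
proof -
  have "{1..<3::nat} = {1, 2}" by auto
  then show ?thesis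
    by (subst algebra_power.simps) (simp add: algebra_power_1[simplified])
qed

lemma triple_product_in_algebra_power_3: "mul x (mul y z) \<in> algebra_power sc mul 3"
proof -
  have "mul x (mul y z) + 0 \<in> algebra_power sc mul 3"
    unfolding algebra_power_3 algebra_power_2
    by (intro set_plus_intro mul_in_product_span zero_in_product_span) auto
  then show ?thesis by simp
qed

text \<open>By bilinearity it is enough to look at single triple products, although the square of the
  algebra consists of sums of products.\<close>

lemma algebra_power_3_subset:
  assumes W: "module.subspace sc W" and t: "\<And>x y z. mul x (mul y z) \<in> W"
  shows "algebra_power sc mul 3 \<subseteq> W"
proof -
  have "mul x v \<in> W" if "v \<in> algebra_power sc mul 2" for x v
  proof -
    have "v \<in> span {mul a b |a b. a \<in> UNIV \<and> b \<in> UNIV}"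
      using that by (simp add: algebra_power_2 product_span_def)
    then show ?thesis
    proof (induction rule: span_induct_alt)
      case base
      show ?case using subspace_0[OF W] by simp
    next
      case (step c u v)
      then show ?case
        using t by (auto simp: mul_expand intro!: subspace_add[OF W] subspace_scale[OF W])
    qed
  qed
  then have "product_span sc mul UNIV (algebra_power sc mul 2) \<subseteq> W"
    "product_span sc mul (algebra_power sc mul 2) UNIV \<subseteq> W"
    by (auto intro!: product_span_subset[OF W]) (metis mul_commute)
  then show ?thesis
    unfolding algebra_power_3 using subspace_add[OF W] by (auto elim!: set_plus_elim)
qed

end

section \<open>Linear combinations of five vectors\<close>

lemma exhaust_5: "x = 1 \<or> x = 2 \<or> x = 3 \<or> x = 4 \<or> x = 5" for x :: 5
proof (induct x)
  case (of_int z)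
  then have "0 \<le> z" "z < 5" by simp_all
  then have "z = 0 \<or> z = 1 \<or> z = 2 \<or> z = 3 \<or> z = 4" by arith
  then show ?case by auto
qed

lemma sum_5: "sum f (UNIV :: 5 set) = f 1 + f 2 + f 3 + f 4 + f 5"
proof -
  have "(UNIV :: 5 set) = {1, 2, 3, 4, 5}" using exhaust_5 by auto
  then have "sum f UNIV = sum f {1, 2, 3, 4, 5 :: 5}" by (rule arg_cong)
  also have "\<dots> = f 1 + f 2 + f 3 + f 4 + f 5" by (simp add: ac_simps)
  finally show ?thesis .
qed

lemma vec_eq_iff_5:
  "x = y \<longleftrightarrow> x $ 1 = y $ 1 \<and> x $ 2 = y $ 2 \<and> x $ 3 = y $ 3 \<and> x $ 4 = y $ 4 \<and> x $ 5 = y $ 5"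
  for x y :: "'k ^ 5"
proof -
  have "(\<forall>i :: 5. P i) \<longleftrightarrow> P 1 \<and> P 2 \<and> P 3 \<and> P 4 \<and> P 5" for P
    using exhaust_5 by metis
  then show ?thesis by (simp only: vec_eq_iff)
qed

context nonassoc_algebra
begin

definition lincomb5 :: "'a \<Rightarrow> 'a \<Rightarrow> 'a \<Rightarrow> 'a \<Rightarrow> 'a \<Rightarrow> 'k ^ 5 \<Rightarrow> 'a" where
  "lincomb5 e1 e2 e3 e4 e5 v =
     sc (v $ 1) e1 + sc (v $ 2) e2 + sc (v $ 3) e3 + sc (v $ 4) e4 + sc (v $ 5) e5"

lemma linear_lincomb5: "Vector_Spaces.linear (*s) sc (lincomb5 e1 e2 e3 e4 e5)"
  by (intro Vector_Spaces.linear_iff[THEN iffD2] conjI vector_space_axioms vec.vector_space_axioms)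
     (auto simp: lincomb5_def algebra_simps scale_right_distrib scale_left_distrib)

text \<open>A nonzero dimension already forces a finite basis, since \<open>dim\<close> is \<open>0\<close> when bases are
  infinite. An injective linear map between spaces of the same finite dimension is onto.\<close>

lemma bij_lincomb5:
  assumes dim: "dim UNIV = 5"
    and ker: "\<And>v. lincomb5 e1 e2 e3 e4 e5 v = 0 \<Longrightarrow> v = 0"
  shows "bij (lincomb5 e1 e2 e3 e4 e5)" (is "bij ?g")
proof -
  have "\<exists>E. independent E \<and> span E = span UNIV"
    using dim by (auto simp: dim_def split: if_splits)
  then obtain E where E: "independent E" "span E = UNIV"
    by (auto simp: span_UNIV)
  then have "card E = 5"
    using dim dim_eq_card[of E UNIV] by (simp only: span_UNIV simp_thms)
  then have "finite E" using card.infinite by fastforce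
  interpret fin: finite_dimensional_vector_space sc E
    by unfold_locales (use E \<open>finite E\<close> in auto)
  interpret pair: finite_dimensional_vector_space_pair "(*s)" "cart_basis :: ('k ^ 5) set" sc E
    by unfold_locales
  have "inj ?g"
    using ker by (simp add: pair.linear_inj_iff_eq_0[OF linear_lincomb5])
  moreover have "surj ?g"
    by (rule pair.linear_injective_imp_surjective[OF linear_lincomb5 \<open>inj ?g\<close>])
       (simp add: \<open>card E = 5\<close> card_cart_basis)
  ultimately show ?thesis by (simp add: bij_def)
qed

end

section \<open>The algebra B\<close>

lemma B_mul_nth:
  shows "B_mul x y $ 1 = 0"
    and "B_mul x y $ 2 = x $ 1 * y $ 1"
    and "B_mul x y $ 3 = x $ 2 * y $ 4 + x $ 4 * y $ 2 - (x $ 1 * y $ 5 + x $ 5 * y $ 1) / 2"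
    and "B_mul x y $ 4 = 0"
    and "B_mul x y $ 5 = x $ 1 * y $ 4 + x $ 4 * y $ 1"
  by (simp_all add: B_mul_def sum_5 B_table_def B_basis_def axis_def add_divide_distrib)

lemma commutative_algebra_B: "commutative_algebra (*s) (B_mul :: 'k::field ^ 5 \<Rightarrow> _)"
proof -
  have com: "B_mul x y = B_mul y x" for x y :: "'k ^ 5"
    by (simp add: vec_eq_iff_5 B_mul_nth algebra_simps)
  have lin: "Vector_Spaces.linear (*s) (*s) (B_mul x)" for x :: "'k ^ 5"
    by (intro Vector_Spaces.linear_iff[THEN iffD2] conjI vec.vector_space_axioms)
       (auto simp: vec_eq_iff_5 B_mul_nth algebra_simps add_divide_distrib diff_divide_distrib)
  have lin': "Vector_Spaces.linear (*s) (*s) (\<lambda>x. B_mul x y)" for y :: "'k ^ 5"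
    using lin[of y] by (subst com)
  show ?thesis
    by (intro commutative_algebra.intro commutative_algebra_axioms.intro nonassoc_algebra.intro
        nonassoc_algebra_axioms.intro vec.vector_space_axioms lin lin' com)
qed

lemma jordan_algebra_B: "jordan_algebra (*s) (B_mul :: 'k::field ^ 5 \<Rightarrow> _)"
proof -
  interpret commutative_algebra "(*s)" "B_mul :: 'k ^ 5 \<Rightarrow> _" by (rule commutative_algebra_B)
  show ?thesis
    by unfold_locales (simp add: vec_eq_iff_5 B_mul_nth)
qed

lemma jacobi_jordan_algebra_B:
  assumes two: "(2::'k::field) \<noteq> 0"
  shows "jacobi_jordan_algebra (*s) (B_mul :: 'k ^ 5 \<Rightarrow> _)"
proof -
  interpret commutative_algebra "(*s)" "B_mul :: 'k ^ 5 \<Rightarrow> _" by (rule commutative_algebra_B)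
  \<comment> \<open>Only the third coordinate of a triple product is nonzero; each cubic monomial enters the cyclic
    sum once with coefficient \<open>1\<close> and twice with coefficient \<open>- 1 / 2\<close>.\<close>
  have cyclic: "(p - (q + r) / 2) + (q - (r + p) / 2) + (r - (p + q) / 2) = 0" for p q r :: 'k
  proof -
    have "(q + r) / 2 + (r + p) / 2 + (p + q) / 2 = (2 * (p + q + r)) / 2"
      by (simp only: add_divide_distrib[symmetric]) (simp add: algebra_simps)
    also have "\<dots> = p + q + r" using two by simp
    finally show ?thesis by (simp add: algebra_simps)
  qed
  define h where "h u v w = u $ 1 * (v $ 1 * w $ 4)" for u v w :: "'k ^ 5"
  have h_commute: "h u v w = h v u w" for u v w
    by (simp only: h_def mult.left_commute)
  have third: "B_mul u (B_mul v w) $ 3 = h v w u - (h w u v + h u v w) / 2" for u v w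
    by (simp add: B_mul_nth h_commute[of w u] mult.commute[of "u $ 4"])
      (simp only: h_def distrib_left mult.assoc add.commute mult.commute[of "v $ 4"])
  have "B_mul x (B_mul y z) + B_mul y (B_mul z x) + B_mul z (B_mul x y) = 0" for x y z :: "'k ^ 5"
    unfolding vec_eq_iff_5 vector_add_component third
    using cyclic[of "h y z x" "h z x y" "h x y z"] by (simp add: B_mul_nth)
  then show ?thesis by unfold_locales
qed

text \<open>The products \<open>(e\<^sub>1 e\<^sub>1) e\<^sub>4 = e\<^sub>3\<close> and \<open>e\<^sub>1 (e\<^sub>1 e\<^sub>4) = - e\<^sub>3 / 2\<close> differ, as they agree only
  in characteristic \<open>3\<close>.\<close>

lemma B_not_associative:
  assumes "(2::'k::field) \<noteq> 0" and "(3::'k) \<noteq> 0"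
  shows "\<not> associative_mul (B_mul :: 'k ^ 5 \<Rightarrow> _)"
proof
  assume "associative_mul (B_mul :: 'k ^ 5 \<Rightarrow> _)"
  then have "B_mul (B_mul (axis 1 1) (axis 1 1)) (axis 4 1) $ 3
    = B_mul (axis 1 1) (B_mul (axis 1 1) (axis 4 (1::'k))) $ 3"
    by (simp add: associative_mul_def)
  then have "(1::'k) = - (1 / 2)" by (simp add: B_mul_nth axis_def)
  then have "(2::'k) = - 1" using assms(1) by (simp add: field_simps)
  then have "(3::'k) = 0" by (metis add.left_inverse one_plus_numeral semiring_norm(3) add.commute)
  then show False using assms(2) by simp
qed

lemma B_algebra_power_3: "algebra_power (*s) (B_mul :: 'k::field ^ 5 \<Rightarrow> _) 3 \<noteq> {0}"
proof -
  interpret commutative_algebra "(*s)" "B_mul :: 'k ^ 5 \<Rightarrow> _" by (rule commutative_algebra_B)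
  let ?t = "B_mul (axis 4 1) (B_mul (axis 1 1) (axis 1 1)) :: 'k ^ 5"
  have "?t $ 3 = 1" by (simp add: B_mul_nth axis_def)
  then have "?t \<noteq> 0" by (metis zero_index zero_neq_one)
  then show ?thesis using triple_product_in_algebra_power_3 by blast
qed

text \<open>The powers of \<open>B\<close> lie in a flag of coordinate subspaces: \<open>B\<^sup>2\<close> in the span of \<open>e\<^sub>2, e\<^sub>3, e\<^sub>5\<close> and
  \<open>B\<^sup>3\<close> in the span of \<open>e\<^sub>3\<close>. The vector \<open>e\<^sub>3\<close> annihilates \<open>B\<close>, and the products within the former
  span vanish, so every summand of \<open>B\<^sup>4\<close> is zero.\<close>

lemma B_algebra_power_4: "algebra_power (*s) (B_mul :: 'k::field ^ 5 \<Rightarrow> _) 4 = {0}"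
proof -
  interpret commutative_algebra "(*s)" "B_mul :: 'k ^ 5 \<Rightarrow> _" by (rule commutative_algebra_B)
  define W2 :: "('k ^ 5) set" where "W2 = {v. v $ 1 = 0 \<and> v $ 4 = 0}"
  define W3 :: "('k ^ 5) set" where "W3 = {v. v $ 1 = 0 \<and> v $ 2 = 0 \<and> v $ 4 = 0 \<and> v $ 5 = 0}"
  have W: "vec.subspace W2" "vec.subspace W3"
    by (auto simp: W2_def W3_def vec.subspace_def)
  have P2: "algebra_power (*s) B_mul 2 \<subseteq> W2"
    unfolding algebra_power_2
    by (rule product_span_subset[OF W(1)]) (simp add: W2_def B_mul_nth)
  have P3: "algebra_power (*s) B_mul 3 \<subseteq> W3"
    by (rule algebra_power_3_subset[OF W(2)]) (simp add: W3_def B_mul_nth)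
  have "product_span (*s) B_mul (algebra_power (*s) B_mul i) (algebra_power (*s) B_mul (4 - i))
    \<subseteq> {0 :: 'k ^ 5}" if "1 \<le> i" "i < 4" for i :: nat
  proof (rule product_span_subset[OF vec.subspace_single_0])
    fix u v :: "'k ^ 5"
    assume u: "u \<in> algebra_power (*s) B_mul i" and v: "v \<in> algebra_power (*s) B_mul (4 - i)"
    have "i = 1 \<or> i = 2 \<or> i = 3" using that by auto
    then have "v \<in> W3 \<or> u \<in> W3 \<or> u \<in> W2 \<and> v \<in> W2"
      using u v P2 P3 by auto
    then show "B_mul u v \<in> {0}"
      by (auto simp: W2_def W3_def vec_eq_iff_5 B_mul_nth)
  qed
  then have "algebra_power (*s) B_mul 4 \<subseteq> {0 :: 'k ^ 5}"
    by (intro algebra_power_subset vec.subspace_single_0) auto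
  moreover have "(0 :: 'k ^ 5) \<in> algebra_power (*s) B_mul 4"
    by (rule zero_in_algebra_power)
  ultimately show ?thesis by blast
qed

section \<open>Recognising B by a multiplication table\<close>

lemma (in commutative_algebra) isomorphic_to_B:
  assumes dim: "dim UNIV = 5"
    and ker: "\<And>v. lincomb5 e1 e2 e3 e4 e5 v = 0 \<Longrightarrow> v = 0"
    and table: "mul e1 e1 = e2" "mul e1 e2 = 0" "mul e1 e3 = 0" "mul e1 e4 = e5"
      "mul e1 e5 = sc (- (1 / 2)) e3"
      "mul e2 e2 = 0" "mul e2 e3 = 0" "mul e2 e4 = e3" "mul e2 e5 = 0"
      "mul e3 e3 = 0" "mul e3 e4 = 0" "mul e3 e5 = 0"
      "mul e4 e4 = 0" "mul e4 e5 = 0" "mul e5 e5 = 0"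
  shows "algebra_isomorphic sc mul (*s) B_mul"
proof -
  let ?g = "lincomb5 e1 e2 e3 e4 e5"
  have bij: "bij ?g" by (rule bij_lincomb5[OF dim ker])
  have hom: "?g (B_mul u v) = mul (?g u) (?g v)" for u v
    by (simp add: lincomb5_def B_mul_nth mul_expand table mul_commute[of e2 e1]
        mul_commute[of e3 e1] mul_commute[of e4 e1] mul_commute[of e5 e1]
        mul_commute[of e3 e2] mul_commute[of e4 e2] mul_commute[of e5 e2]
        mul_commute[of e4 e3] mul_commute[of e5 e3] mul_commute[of e5 e4]
        scale_left_distrib scale_left_diff_distrib scale_right_distrib add_divide_distrib
        algebra_simps)
  have lin: "Vector_Spaces.linear (*s) sc ?g" by (rule linear_lincomb5)
  have "Vector_Spaces.linear sc (*s) (inv ?g)"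
  proof (intro Vector_Spaces.linear_iff[THEN iffD2] conjI vector_space_axioms vec.vector_space_axioms allI)
    fix x y c
    show "inv ?g (x + y) = inv ?g x + inv ?g y"
      using bij by (intro inv_f_eq bij_is_inj)
        (simp_all add: module_hom.add[OF lin[unfolded linear_iff_module_hom]] bij_is_surj surj_f_inv_f)
    show "inv ?g (sc c x) = c *s inv ?g x"
      using bij by (intro inv_f_eq bij_is_inj)
        (simp_all add: module_hom.scale[OF lin[unfolded linear_iff_module_hom]] bij_is_surj surj_f_inv_f)
  qed
  moreover have "inv ?g (mul x y) = B_mul (inv ?g x) (inv ?g y)" for x y
    using bij by (intro inv_f_eq bij_is_inj) (simp_all add: hom bij_is_surj surj_f_inv_f)
  ultimately show ?thesis
    unfolding algebra_isomorphic_def using bij bij_imp_bij_inv by blast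
qed

section \<open>Jacobi-Jordan algebras\<close>

context jacobi_jordan_algebra
begin

lemma mul_mul_left: "mul (mul x y) z = - mul x (mul y z) - mul y (mul x z)"
  using jacobi[of x y z]
  by (simp add: mul_commute[of z x] mul_commute[of z "mul x y"] eq_neg_iff_add_eq_0 algebra_simps)

lemma square_mul: "mul (mul x x) y = sc (- 2) (mul x (mul x y))"
proof -
  have "sc (- 1 + - 1) v = - v - v" for v
    unfolding scale_left_distrib by simp
  then show ?thesis using mul_mul_left[of x x y] by simp
qed

lemma cube_zero:
  assumes "(3::'a) \<noteq> 0"
  shows "mul x (mul x x) = 0"
  using jacobi[of x x x] triple_eq_0D[OF assms] by blast

text \<open>The identity \<open>L\<^sub>x\<^sub>y = - (L\<^sub>x L\<^sub>y + L\<^sub>y L\<^sub>x)\<close> with \<open>x x\<close> for \<open>y\<close> has left side \<open>0\<close>, because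
  \<open>x (x x) = 0\<close>, and right side \<open>4 L\<^sub>x\<^sup>3\<close>, because \<open>L\<^sub>x\<^sub>x = - 2 L\<^sub>x\<^sup>2\<close>.\<close>

lemma mul_cubed_zero:
  assumes "(2::'a) \<noteq> 0" "(3::'a) \<noteq> 0"
  shows "mul x (mul x (mul x y)) = 0"
proof -
  let ?t = "mul x (mul x (mul x y))"
  have "mul x (mul (mul x x) y) = sc (- 2) ?t" "mul (mul x x) (mul x y) = sc (- 2) ?t"
    by (simp_all only: square_mul mul_sc_right)
  moreover have "- mul x (mul (mul x x) y) - mul (mul x x) (mul x y) = 0"
    using mul_mul_left[of x "mul x x" y] by (simp add: cube_zero assms)
  ultimately have "sc (2 + 2) ?t = 0"
    unfolding scale_left_distrib by simp
  moreover have "(2::'a) + 2 \<noteq> 0" using assms(1) by (simp only: mult_2[symmetric] mult_eq_0_iff) simp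
  ultimately show ?thesis by simp
qed

text \<open>With \<open>p \<noteq> 0\<close> also \<open>q \<noteq> 0\<close>, and the nilpotent operator \<open>L\<^sub>y\<close> would have the nonzero
  eigenvalue \<open>p / q\<close>. The homogeneous form covers both an eigenvector of \<open>L\<^sub>y\<close> and a linear relation between \<open>u\<close> and \<open>y u\<close>.\<close>

lemma no_eigenvector:
  assumes "(2::'a) \<noteq> 0" "(3::'a) \<noteq> 0"
    and eq: "sc p u = sc q (mul y u)" and "u \<noteq> 0"
  shows "p = 0"
proof -
  have "sc (p * p * p) u = sc (p * p) (sc p u)" by simp
  also have "\<dots> = sc (p * q) (mul y (sc p u))"
    by (subst eq) (simp add: mul_sc_right mult_ac)
  also have "\<dots> = sc (q * q) (mul y (mul y (sc p u)))"
    by (subst eq) (simp add: mul_sc_right mult_ac)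
  also have "\<dots> = 0"
    by (subst eq) (simp add: mul_sc_right mul_cubed_zero assms)
  finally show ?thesis using \<open>u \<noteq> 0\<close> by simp
qed

text \<open>Otherwise \<open>L\<^sub>a\<^sub>a = 0\<close> for all \<open>a\<close>; polarising, \<open>L\<^sub>x\<^sub>y = 0\<close> for all \<open>x\<close> and \<open>y\<close>, so all triple
  products vanish and the algebra is associative.\<close>

lemma nonassociative_obtains:
  assumes "(2::'a) \<noteq> 0" and "\<not> associative_mul mul"
  obtains a y where "mul (mul a a) y \<noteq> 0"
proof (rule ccontr)
  assume "\<not> thesis"
  with that have sq: "mul (mul a a) y = 0" for a y by blast
  have zero: "mul (mul x y) z = 0" for x y z
  proof (rule double_eq_0D[OF assms(1)])
    show "mul (mul x y) z + mul (mul x y) z = 0"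
      using sq[of "x + y" z] by (simp add: mul_add_left mul_add_right sq mul_commute[of y x])
  qed
  have "associative_mul mul"
    unfolding associative_mul_def using zero mul_commute by metis
  with assms(2) show False by contradiction
qed

text \<open>The three terms of the Jacobi identity coincide, so three times the product is zero.\<close>

lemma associative_triple_product_zero:
  assumes "(3::'a) \<noteq> 0" and assoc: "associative_mul mul"
  shows "mul x (mul y z) = 0"
proof -
  have "mul y (mul z x) = mul x (mul y z)" "mul z (mul x y) = mul x (mul y z)"
    using assoc mul_commute unfolding associative_mul_def by metis+
  then have "mul x (mul y z) + mul x (mul y z) + mul x (mul y z) = 0"
    using jacobi[of x y z] by simp
  then show ?thesis by (rule triple_eq_0D[OF assms(1)])
qed

end

section \<open>Classification in dimension five\<close>

text \<open>The vectors \<open>a, b, z, y, w\<close> are going to play the roles of \<open>e\<^sub>1, e\<^sub>2, e\<^sub>3, e\<^sub>4, e\<^sub>5\<close>. Naming the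
  derived vectors as parameters lets the locale be entered a second time with a better \<open>y\<close>.\<close>

locale nonassociative_pair = jacobi_jordan_algebra +
  fixes a y b z w
  assumes two: "(2::'a) \<noteq> 0" and three: "(3::'a) \<noteq> 0"
    and b_def: "b = mul a a" and z_def: "z = mul b y" and w_def: "w = mul a y"
    and z_nonzero: "z \<noteq> 0"
begin

lemma mul_a_b: "mul a b = 0"
  by (simp add: b_def cube_zero three)

lemma z_eq: "z = sc (- 2) (mul a w)"
  by (simp add: z_def b_def w_def square_mul)

lemma mul_a_w: "mul a w = sc (- (1 / 2)) z"
  using two by (simp add: z_eq)

lemma mul_a_z: "mul a z = 0"
  by (simp add: z_eq mul_sc_right w_def mul_cubed_zero two three)

lemma mul_b: "mul b u = sc (- 2) (mul a (mul a u))"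
  by (simp add: b_def square_mul)

lemma mul_b_b: "mul b b = 0"
  and mul_b_z: "mul b z = 0"
  and mul_b_w: "mul b w = 0"
  by (simp_all add: mul_b mul_a_b mul_a_z mul_a_w mul_sc_right)

lemmas mul_ab = mul_a_b mul_a_w mul_a_z mul_b_b mul_b_z mul_b_w

text \<open>Applying \<open>L\<^sub>a\<close> twice kills everything except the term with \<open>y\<close>. Applying it once then leaves a
  relation between \<open>b\<close> and \<open>z = y b\<close>, which is trivial because \<open>L\<^sub>y\<close> is nilpotent; what remains of the
  original combination is again such a relation.\<close>

lemma lincomb5_eq_0D:
  assumes "lincomb5 a b z y w v = 0"
  shows "v = 0"
proof -
  have comb: "sc (v $ 1) a + sc (v $ 2) b + sc (v $ 3) z + sc (v $ 4) y + sc (v $ 5) w = 0"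
    using assms by (simp add: lincomb5_def)
  have "b \<noteq> 0" using z_nonzero z_def by auto
  note no_eigenvector_b = no_eigenvector[OF two three _ \<open>b \<noteq> 0\<close>]
  have y_b: "mul y b = z" by (simp add: z_def mul_commute)
  have "mul a (mul a (sc (v $ 1) a + sc (v $ 2) b + sc (v $ 3) z + sc (v $ 4) y + sc (v $ 5) w)) = 0"
    by (simp add: comb)
  then have v4: "v $ 4 = 0"
    using two z_nonzero
    by (simp add: mul_expand mul_ab flip: b_def w_def)
  have "mul a (sc (v $ 1) a + sc (v $ 2) b + sc (v $ 3) z + sc (v $ 4) y + sc (v $ 5) w) = 0"
    by (simp add: comb)
  then have *: "sc (v $ 1) b + sc (- (v $ 5 / 2)) z = 0"
    by (simp add: mul_expand mul_ab v4 flip: b_def w_def)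
  then have "sc (v $ 1) b = sc (v $ 5 / 2) (mul y b)"
    by (simp add: y_b)
  then have v1: "v $ 1 = 0" by (rule no_eigenvector_b)
  with * have v5: "v $ 5 = 0" using two z_nonzero by simp
  have **: "sc (v $ 2) b + sc (v $ 3) z = 0" using comb by (simp add: v1 v4 v5)
  then have "sc (v $ 2) b = sc (- (v $ 3)) (mul y b)"
    by (simp add: y_b eq_neg_iff_add_eq_0)
  then have v2: "v $ 2 = 0" by (rule no_eigenvector_b)
  with ** have v3: "v $ 3 = 0" using z_nonzero by simp
  show ?thesis by (simp add: vec_eq_iff_5 v1 v2 v3 v4 v5)
qed

text \<open>If \<open>y y = 0\<close>, then \<open>L\<^sub>y\<^sup>2 = - L\<^sub>y\<^sub>y / 2 = 0\<close>, so \<open>y w = y (y a)\<close> and \<open>y z = y (y b)\<close> vanish; the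
  products among \<open>w = a y\<close> and \<open>z = b y\<close> then follow from \<open>L\<^sub>x\<^sub>y = - (L\<^sub>x L\<^sub>y + L\<^sub>y L\<^sub>x)\<close>.\<close>

lemma isomorphic_to_B_if_square_zero:
  assumes dim: "dim UNIV = 5" and yy: "mul y y = 0"
  shows "algebra_isomorphic sc mul (*s) B_mul"
proof -
  have y: "mul y (mul y u) = 0" for u
    using square_mul[of y u] yy two by simp
  have yw: "mul y w = 0" using y[of a] by (simp add: w_def mul_commute)
  have yz: "mul y z = 0" using y[of b] by (simp add: z_def mul_commute)
  have ww: "mul w w = 0"
    using mul_mul_left[of a y w] by (simp add: yw yz mul_ab mul_sc_right flip: w_def)
  have wz: "mul w z = 0"
    using mul_mul_left[of a y z] by (simp add: yz mul_ab flip: w_def)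
  have zz: "mul z z = 0"
    using mul_mul_left[of b y z] by (simp add: yz mul_ab flip: z_def)
  have zy: "mul z y = 0" and zw: "mul z w = 0"
    using yz wz by (simp_all only: mul_commute[of z y] mul_commute[of z w])
  note squares = b_def[symmetric] w_def[symmetric] z_def[symmetric]
  show ?thesis
    by (rule isomorphic_to_B[of a b z y w, OF dim])
       (fact lincomb5_eq_0D mul_ab squares yy yw ww zy zw zz)+
qed

text \<open>Expanded in the basis, \<open>y y\<close> has no \<open>y\<close>-component, because that component would give \<open>L\<^sub>y\<close> the
  eigenvector \<open>z\<close> with a nonzero eigenvalue. The identity \<open>y (y y) = 0\<close> then gives
  \<open>y y = - (\<delta>\<^sup>2 / 4) b + \<zeta> z + \<delta> w\<close>, which is completed to a square: for
  \<open>y' = y + s a + t b\<close> one has \<open>y' y' = y y + s\<^sup>2 b + 2 s w + 2 t z\<close>.\<close>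

lemma square_zero_replacement:
  assumes dim: "dim UNIV = 5"
  obtains y' where "mul y' y' = 0" and "mul b y' = z"
proof -
  obtain v where "mul y y = lincomb5 a b z y w v"
    using bij_lincomb5[OF dim lincomb5_eq_0D] by (metis bij_pointE)
  then obtain \<alpha> \<beta> \<zeta> \<gamma> \<delta>
    where yy: "mul y y = sc \<alpha> a + sc \<beta> b + sc \<zeta> z + sc \<gamma> y + sc \<delta> w"
    unfolding lincomb5_def by blast
  have comm: "mul a y = w" "mul y a = w" "mul y b = z" "mul b y = z" "mul a a = b" "mul b a = 0"
    "mul z b = 0" "mul w b = 0" "mul z a = 0" "mul w a = sc (- (1 / 2)) z"
    by (simp_all add: w_def[symmetric] z_def[symmetric] b_def[symmetric] mul_commute[of y]
        mul_commute[of b a] mul_commute[of z] mul_commute[of w] mul_ab)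
  have half: "mul y (mul y u) = sc (- (1 / 2)) (mul (mul y y) u)" for u
    using two by (simp add: square_mul)
  have yz: "mul y z = sc (- (\<gamma> / 2)) z"
    using half[of b] by (simp add: yy mul_expand comm mul_ab)
  then have "sc (- (\<gamma> / 2)) z = sc 1 (mul y z)" by simp
  then have "- (\<gamma> / 2) = 0" by (rule no_eigenvector[OF two three _ z_nonzero])
  then have \<gamma>: "\<gamma> = 0" using two by simp
  have yw: "mul y w = sc (- (\<alpha> / 2)) b + sc (\<delta> / 4) z"
    using half[of a] by (simp add: yy mul_expand comm mul_ab \<gamma> scale_right_distrib
        scale_right_diff_distrib)
  have "mul y (mul y y) = 0" by (rule cube_zero[OF three])
  then have "sc \<alpha> w + sc \<beta> z + sc \<delta> (mul y w) = 0"
    by (simp add: yy mul_add_right mul_sc_right comm yz \<gamma>)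
  then have "sc (- (\<delta> * \<alpha> / 2)) b + sc (\<beta> + \<delta> * \<delta> / 4) z + sc \<alpha> w = 0"
    by (simp add: yw scale_left_distrib scale_right_distrib algebra_simps)
  then have "lincomb5 a b z y w
      (\<chi> i. if i = 2 then - (\<delta> * \<alpha> / 2) else if i = 3 then \<beta> + \<delta> * \<delta> / 4
        else if i = 5 then \<alpha> else 0) = 0"
    (is "lincomb5 a b z y w ?v = 0")
    by (simp add: lincomb5_def)
  then have "?v = 0" by (rule lincomb5_eq_0D)
  then have \<alpha>: "\<alpha> = 0" and \<beta>: "\<beta> = - (\<delta> * \<delta> / 4)"
    by (simp_all add: vec_eq_iff_5 eq_neg_iff_add_eq_0)
  define y' where "y' = y + sc (- (\<delta> / 2)) a + sc (- (\<zeta> / 2)) b"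
  have double: "sc (c / 2) v + sc (c / 2) v = sc c v" for c v
    using two by (simp flip: scale_left_distrib)
  have "mul y' y' = 0"
    using double[of \<delta> w] double[of \<zeta> z]
    by (simp add: y'_def mul_expand comm mul_ab yy \<alpha> \<beta> \<gamma> algebra_simps)
  moreover have "mul b y' = z"
    by (simp add: y'_def mul_expand comm mul_ab)
  ultimately show thesis by (rule that)
qed

end

lemma (in jacobi_jordan_algebra) associative_or_isomorphic_to_B:
  assumes "(2::'a) \<noteq> 0" and "(3::'a) \<noteq> 0" and dim: "dim UNIV = 5"
  shows "associative_mul mul \<or> algebra_isomorphic sc mul (*s) B_mul"
proof (cases "associative_mul mul")
  case False
  then obtain a y where ay: "mul (mul a a) y \<noteq> 0"
    by (rule nonassociative_obtains[OF assms(1)])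
  interpret p: nonassociative_pair sc mul a y "mul a a" "mul (mul a a) y" "mul a y"
    by unfold_locales (use assms ay in auto)
  obtain y' where y': "mul y' y' = 0" "mul (mul a a) y' = mul (mul a a) y"
    by (rule p.square_zero_replacement[OF dim])
  interpret q: nonassociative_pair sc mul a y' "mul a a" "mul (mul a a) y'" "mul a y'"
    by unfold_locales (use assms ay y' in auto)
  have "algebra_isomorphic sc mul (*s) B_mul"
    by (rule q.isomorphic_to_B_if_square_zero[OF dim y'(1)])
  then show ?thesis ..
qed simp

lemma of_nat_prime_neq_0_if_CHAR_neq:
  assumes "prime p" and "CHAR('k::field) \<noteq> p"
  shows "of_nat p \<noteq> (0::'k)"
proof
  assume "of_nat p = (0::'k)"
  then have "CHAR('k) dvd p" by (rule of_nat_eq_0_iff_char_dvd[THEN iffD1])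
  then have "CHAR('k) = 1" using assms unfolding prime_nat_iff by blast
  then show False using of_nat_CHAR[where 'a = 'k] by simp
qed

theorem proposition4p1:
  assumes "CHAR('k::alg_closed_field) \<noteq> 2" and "CHAR('k) \<noteq> 3"
  shows
    "(\<forall>(sc :: 'k \<Rightarrow> 'a::ab_group_add \<Rightarrow> 'a) mul.
        jacobi_jordan_algebra sc mul \<and> vector_space.dim sc UNIV = 5 \<longrightarrow>
          associative_mul mul \<or>
          algebra_isomorphic sc mul (*s) (B_mul :: 'k ^ 5 \<Rightarrow> 'k ^ 5 \<Rightarrow> 'k ^ 5)) \<and>
     \<not> associative_mul (B_mul :: 'k ^ 5 \<Rightarrow> 'k ^ 5 \<Rightarrow> 'k ^ 5) \<and>
     (jordan_algebra (*s) (B_mul :: 'k ^ 5 \<Rightarrow> 'k ^ 5 \<Rightarrow> 'k ^ 5) \<and>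
      vector_space.dim (*s) (UNIV :: ('k ^ 5) set) = 5 \<and>
      nilpotent_algebra (*s) (B_mul :: 'k ^ 5 \<Rightarrow> 'k ^ 5 \<Rightarrow> 'k ^ 5) \<and>
      nilalgebra_of_nilindex (B_mul :: 'k ^ 5 \<Rightarrow> 'k ^ 5 \<Rightarrow> 'k ^ 5) 3 \<and>
      algebra_power (*s) (B_mul :: 'k ^ 5 \<Rightarrow> 'k ^ 5 \<Rightarrow> 'k ^ 5) 3 \<noteq> {0}) \<and>
     (\<forall>(sc :: 'k \<Rightarrow> 'a \<Rightarrow> 'a) mul.
        jordan_algebra sc mul \<and> vector_space.dim sc UNIV = 5 \<and>
        nilpotent_algebra sc mul \<and> nilalgebra_of_nilindex mul 3 \<and>
        algebra_power sc mul 3 \<noteq> {0} \<longrightarrow>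
          algebra_isomorphic sc mul (*s) (B_mul :: 'k ^ 5 \<Rightarrow> 'k ^ 5 \<Rightarrow> 'k ^ 5))"
proof -
  have two: "(2::'k) \<noteq> 0" using of_nat_prime_neq_0_if_CHAR_neq[of 2] assms(1) by simp
  have three: "(3::'k) \<noteq> 0" using of_nat_prime_neq_0_if_CHAR_neq[of 3] assms(2) by simp
  have classification: "associative_mul mul \<or> algebra_isomorphic sc mul (*s) (B_mul :: 'k ^ 5 \<Rightarrow> _)"
    if "jacobi_jordan_algebra sc mul" "vector_space.dim sc UNIV = 5"
    for sc :: "'k \<Rightarrow> 'a \<Rightarrow> 'a" and mul
    using jacobi_jordan_algebra.associative_or_isomorphic_to_B[OF that(1) two three that(2)] .
  have power: "principal_power m x 3 = m x (m x x)" "principal_power m x 2 = m x x"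
    for m :: "'b::zero \<Rightarrow> 'b \<Rightarrow> 'b" and x
    by (simp_all add: numeral_3_eq_3 numeral_2_eq_2)
  have nilindex_3_class: "algebra_isomorphic sc mul (*s) (B_mul :: 'k ^ 5 \<Rightarrow> _)"
    if jordan: "jordan_algebra sc mul" and dim: "vector_space.dim sc UNIV = 5"
      and nil: "nilalgebra_of_nilindex mul 3" and nonzero: "algebra_power sc mul 3 \<noteq> {0}"
    for sc :: "'k \<Rightarrow> 'a \<Rightarrow> 'a" and mul
  proof -
    interpret jordan_algebra sc mul by (rule jordan)
    have "mul x (mul x x) = 0" for x
      using nil unfolding nilalgebra_of_nilindex_def power by blast
    then interpret jacobi_jordan_algebra sc mul
      by unfold_locales (rule jacobi_if_cubes_zero[OF two])
    have "\<not> associative_mul mul"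
    proof
      assume "associative_mul mul"
      then have "algebra_power sc mul 3 \<subseteq> {0}"
        using associative_triple_product_zero[OF three]
        by (intro algebra_power_3_subset subspace_single_0) auto
      moreover have "0 \<in> algebra_power sc mul 3" by (rule zero_in_algebra_power)
      ultimately show False using nonzero by blast
    qed
    with classification[OF jacobi_jordan_algebra_axioms dim] show ?thesis by blast
  qed
  have nilB: "nilalgebra_of_nilindex (B_mul :: 'k ^ 5 \<Rightarrow> _) 3"
  proof -
    interpret jacobi_jordan_algebra "(*s)" "B_mul :: 'k ^ 5 \<Rightarrow> _"
      by (rule jacobi_jordan_algebra_B[OF two])
    have "B_mul (axis 1 1) (axis 1 1) $ 2 = (1::'k)" by (simp add: B_mul_nth axis_def)
    then have "B_mul (axis 1 1) (axis 1 1) \<noteq> (0 :: 'k ^ 5)" by (metis zero_index zero_neq_one)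
    then show ?thesis
      unfolding nilalgebra_of_nilindex_def by (auto simp: power cube_zero three)
  qed
  have nilpotentB: "nilpotent_algebra (*s) (B_mul :: 'k ^ 5 \<Rightarrow> _)"
    unfolding nilpotent_algebra_def using B_algebra_power_4 by (intro exI[of _ 4]) simp
  have dimB: "vec.dim (UNIV :: ('k ^ 5) set) = 5"
    by (simp add: card_cart_basis)
  show ?thesis
    by (intro conjI allI impI; (elim conjE)?)
      ((fact classification B_not_associative[OF two three] jordan_algebra_B dimB nilpotentB nilB
        B_algebra_power_3)+, rule nilindex_3_class)
qed

end
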